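(* Fix $0<\varepsilon\le 1$. For an odd prime $p$ and integer $\ell\ge1$ let $S_\ell(p)=\sum_{n\le\ell}\left(\frac{n}{p}\right)$ (Legendre symbol). For $x\ge 2$ let $\pi_{\mathrm{odd}}(x)$ be the number of odd primes $p\le x$, and for integers $\ell\ge1$ define $$P_\ell(x):=\frac{1}{\pi_{\mathrm{odd}}(x)}\#\{p\le x \text{ odd prime}:\ S_\ell(p)\ge \varepsilon\ell\}.$$ Fix $\kappa\in(0,1/6)$. Then for any real $\beta$ with $0<\beta<\frac13-2\kappa$, $$\sum_{\ell>x^{1/6-\kappa}}P_\ell(x)\ll_{\varepsilon,\kappa,\beta}x^{-\beta}.$$
   Context: $f\ll_{z_1,\dots,z_r} g$ means $|f|\le Cg$ with $C$ depending only on $z_1,\dots,z_r$, for all sufficiently large $x$. *)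

theory Defs
  imports "HOL-Analysis.Analysis" "HOL-Number_Theory.Number_Theory"
begin

definition char_sum :: "nat \<Rightarrow> nat \<Rightarrow> int" where
  "char_sum l p = (\<Sum>n=1..l. Legendre (int n) (int p))"

definition pi_odd :: "real \<Rightarrow> nat" where
  "pi_odd x = card {p::nat. prime p \<and> odd p \<and> real p \<le> x}"

definition P_prob :: "real \<Rightarrow> nat \<Rightarrow> real \<Rightarrow> real" where
  "P_prob eps l x =
     real (card {p::nat. prime p \<and> odd p \<and> real p \<le> x \<and> real_of_int (char_sum l p) \<ge> eps * real l})
       / real (pi_odd x)"

end

theory Submission
  imports Defs "HOL-Real_Asymp.Real_Asymp"
begin

text \<open>
  The argument is Linnik's large sieve, in the dual form. Let \<open>B\<close> be the set of odd primes \<open>p \<le> x\<close> with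
  \<open>S\<^sub>l(p) \<ge> \<epsilon>l\<close>. Summing \<open>S\<^sub>l(p)^k\<close> over \<open>B\<close>, swapping sums and applying Cauchy--Schwarz leads to
  the sums of \<open>(n/p)(n/q)\<close> over \<open>n \<le> l^k\<close>, which for \<open>p \<noteq> q\<close> are at most \<open>pq \<le> x\<^sup>2\<close> because a
  full period sums to zero. Once \<open>l^k \<ge> x\<^sup>3\<close> the diagonal dominates, and the divisor bound
  gives \<open>card B \<lesssim> x^(1/12)\<close>. Averaging over shifts shows that \<open>B\<close> is empty unless \<open>l \<lesssim> x^(1/2)\<close>.
  With Chebyshev's lower bound for the number of primes, the sum is
  \<open>\<lesssim> x^(1/2 + 1/12 - 11/12) = x^(-1/3)\<close>, which is stronger than what is claimed.
\<close>

section \<open>The Legendre symbol as a real character\<close>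

text \<open>The modulus comes first, so that \<open>chi p\<close> is the quadratic character itself;
  real values suit Cauchy--Schwarz.\<close>

definition chi :: "nat \<Rightarrow> nat \<Rightarrow> real" where
  "chi p n = of_int (Legendre (int n) (int p))"

lemma char_sum_eq_sum_chi: "real_of_int (char_sum l p) = (\<Sum>n=1..l. chi p n)"
  by (simp add: char_sum_def chi_def)

lemma abs_chi_le_1: "\<bar>chi p n\<bar> \<le> 1"
  by (simp add: chi_def Legendre_def)

lemma chi_cong: "[m = n] (mod p) \<Longrightarrow> chi p m = chi p n"
proof -
  assume "[m = n] (mod p)"
  then have *: "[int m = int n] (mod int p)"
    by (simp add: cong_int_iff)
  have "[int m = 0] (mod int p) \<longleftrightarrow> [int n = 0] (mod int p)"
    using * by (simp add: cong_def)
  moreover have "QuadRes (int p) (int m) \<longleftrightarrow> QuadRes (int p) (int n)"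
    using * by (simp add: QuadRes_def cong_def)
  ultimately show ?thesis by (simp add: chi_def Legendre_def)
qed

lemma chi_eq_0_iff: "chi p n = 0 \<longleftrightarrow> p dvd n"
  by (auto simp: chi_def Legendre_def cong_0_iff)

lemma chi_cases: "chi p n \<in> {-1, 0, 1}"
  by (simp add: chi_def Legendre_def)

text \<open>By Euler's criterion both sides are congruent modulo \<open>p\<close>; they differ by at
  most 2, which is less than \<open>p\<close>, so they agree.\<close>

lemma chi_mult:
  assumes "prime p" "odd p"
  shows "chi p (m * n) = chi p m * chi p n"
proof -
  have p: "p > 2" using assms by (metis prime_ge_2_nat le_neq_implies_less even_numeral)
  let ?L = "\<lambda>n. Legendre (int n) (int p)"
  have eu: "[?L n = int n ^ ((p - 1) div 2)] (mod int p)" for n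
    using euler_criterion[of p "int n"] assms p by simp
  have "[?L m * ?L n = int m ^ ((p - 1) div 2) * int n ^ ((p - 1) div 2)] (mod int p)"
    by (intro cong_mult eu)
  then have "[?L (m * n) = ?L m * ?L n] (mod int p)"
    using eu[of "m * n"] by (simp add: cong_def power_mult_distrib)
  then have d: "int p dvd ?L (m * n) - ?L m * ?L n"
    by (simp add: cong_iff_dvd_diff)
  have "\<bar>?L (m * n) - ?L m * ?L n\<bar> \<le> 2"
    by (simp add: Legendre_def)
  then have "?L (m * n) - ?L m * ?L n = 0"
    using d p dvd_imp_le_int[OF _ d] by force
  then show ?thesis unfolding chi_def by (metis eq_iff_diff_eq_0 of_int_mult)
qed

lemma chi_1: "prime p \<Longrightarrow> chi p 1 = 1"
proof -
  assume "prime p"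
  then have "\<not> [1 = 0] (mod int p)"
    using prime_gt_1_nat[of p] by (simp add: cong_def)
  moreover have "QuadRes (int p) 1" unfolding QuadRes_def by (rule exI[of _ 1]) simp
  ultimately show ?thesis by (simp add: chi_def Legendre_def)
qed

text \<open>A primitive root works: if it were a quadratic residue, Euler's criterion would make its
  order \<open>p - 1\<close> divide \<open>(p - 1) div 2\<close>.\<close>

lemma exists_chi_minus_1:
  assumes "prime p" "odd p"
  shows "\<exists>g. chi p g = -1"
proof -
  have p: "p > 2" using assms by (metis prime_ge_2_nat le_neq_implies_less even_numeral)
  obtain g where g: "residue_primroot p g"
    using prime_primitive_root_exists[of p] assms p by auto
  then have cop: "coprime p g" and ord: "ord p g = p - 1"
    by (auto simp: residue_primroot_def totient_prime assms)
  have "\<not> p dvd g"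
    using cop assms(1) by (metis coprime_absorb_left not_prime_unit)
  then have "chi p g \<noteq> 0" by (simp add: chi_eq_0_iff)
  moreover have "chi p g \<noteq> 1"
  proof
    assume "chi p g = 1"
    then have "Legendre (int g) (int p) = 1" by (simp add: chi_def)
    then have "[1 = int g ^ ((p - 1) div 2)] (mod int p)"
      using euler_criterion[of p "int g"] assms p by simp
    then have "[g ^ ((p - 1) div 2) = 1] (mod p)"
      by (simp add: cong_sym flip: cong_int_iff)
    then have "p - 1 dvd (p - 1) div 2"
      using ord by (metis ord_divides)
    moreover have "(p - 1) div 2 < p - 1" "(p - 1) div 2 > 0" using p by auto
    ultimately show False using dvd_imp_le leD by blast
  qed
  ultimately show ?thesis using chi_cases[of p g] by auto
qed

section \<open>Sums over full periods\<close>

text \<open>An affine map with slope coprime to \<open>q\<close> permutes the residues modulo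
  \<open>q\<close>.\<close>

lemma sum_affine_mod:
  fixes f :: "nat \<Rightarrow> 'a::comm_monoid_add"
  assumes "coprime a q" "q > 0" and per: "\<And>m n. [m = n] (mod q) \<Longrightarrow> f m = f n"
  shows "(\<Sum>n<q. f (a * n + b)) = (\<Sum>n<q. f n)"
proof -
  let ?h = "\<lambda>n. (a * n + b) mod q"
  have inj: "inj_on ?h {..<q}"
  proof (rule inj_onI)
    fix m n assume mn: "m \<in> {..<q}" "n \<in> {..<q}" "?h m = ?h n"
    then have "[a * m + b = a * n + b] (mod q)" by (simp add: cong_def)
    then have "[a * m = a * n] (mod q)" by (simp add: cong_add_rcancel_nat)
    then have "[m = n] (mod q)" using assms(1) by (simp add: cong_mult_lcancel_nat)
    then show "m = n" using mn by (simp add: cong_def)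
  qed
  moreover have "?h ` {..<q} \<subseteq> {..<q}" using assms by auto
  ultimately have "bij_betw ?h {..<q} {..<q}"
    by (metis bij_betw_def endo_inj_surj finite_lessThan)
  then have "(\<Sum>n<q. f (?h n)) = (\<Sum>n<q. f n)"
    by (rule sum.reindex_bij_betw)
  moreover have "f (?h n) = f (a * n + b)" for n
    by (rule per) simp
  ultimately show ?thesis by simp
qed

text \<open>Dilation by a nonresidue permutes the terms and also multiplies the sum by -1.\<close>

lemma sum_chi_period:
  assumes "prime p" "odd p"
  shows "(\<Sum>n<p. chi p n) = 0"
proof -
  obtain g where g: "chi p g = -1" using exists_chi_minus_1 assms by blast
  then have "\<not> p dvd g" using chi_eq_0_iff[of p g] by auto
  then have "coprime g p" using assms(1) by (metis prime_imp_coprime coprime_commute)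
  then have "(\<Sum>n<p. chi p (g * n + 0)) = (\<Sum>n<p. chi p n)"
    by (intro sum_affine_mod) (use assms prime_gt_0_nat in \<open>auto intro: chi_cong\<close>)
  then show ?thesis using assms g by (simp add: chi_mult sum_negf)
qed

lemma sum_chi_shift_eq_0:
  assumes "prime p" "odd p"
  shows "(\<Sum>h<p. chi p (n + h)) = 0"
proof -
  have "(\<Sum>h<p. chi p (1 * h + n)) = (\<Sum>n<p. chi p n)"
    by (intro sum_affine_mod) (use assms prime_gt_0_nat in \<open>auto intro: chi_cong\<close>)
  then show ?thesis using sum_chi_period[OF assms] by (simp add: add.commute)
qed

lemma chi_square: "chi p n ^ 2 = (if p dvd n then 0 else 1)"
  using chi_cases[of p n] chi_eq_0_iff[of p n] by auto

text \<open>Dilation by \<open>h\<close> shows that the correlation does not depend on \<open>h\<close>, and the correlations over all \<open>h\<close>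
  sum to zero.\<close>

lemma chi_correlation:
  assumes "prime p" "odd p" "\<not> p dvd h"
  shows "(\<Sum>n<p. chi p n * chi p (n + h)) = -1"
proof -
  define C where "C = (\<lambda>h. \<Sum>n<p. chi p n * chi p (n + h))"
  have p: "p > 1" using assms prime_gt_1_nat by blast
  have eq: "C h = C 1" if h: "\<not> p dvd h" for h
  proof -
    have cop: "coprime h p" using assms(1) h by (metis prime_imp_coprime coprime_commute)
    have "C h = (\<Sum>n<p. chi p (h * n + 0) * chi p ((h * n + 0) + h))"
      unfolding C_def
    proof (rule sum_affine_mod[symmetric])
      fix m n :: nat assume "[m = n] (mod p)"
      then show "chi p m * chi p (m + h) = chi p n * chi p (n + h)"
        using chi_cong[of m n p] chi_cong[of "m + h" "n + h" p] by (simp add: cong_add)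
    qed (use cop p in auto)
    also have "\<dots> = (\<Sum>n<p. chi p h ^ 2 * (chi p n * chi p (n + 1)))"
    proof (rule sum.cong[OF refl])
      fix n
      have "h * n + h = h * (n + 1)" by simp
      then show "chi p (h * n + 0) * chi p ((h * n + 0) + h) = chi p h ^ 2 * (chi p n * chi p (n + 1))"
        using chi_mult[OF assms(1,2), of h n] chi_mult[OF assms(1,2), of h "n + 1"]
        by (simp add: power2_eq_square add.commute)
    qed
    also have "\<dots> = C 1" using h by (simp add: chi_square C_def)
    finally show ?thesis .
  qed
  have "(\<Sum>h<p. C h) = (\<Sum>n<p. chi p n * (\<Sum>h<p. chi p (n + h)))"
    unfolding C_def by (subst sum.swap) (simp add: sum_distrib_left)
  also have "\<dots> = 0" using sum_chi_shift_eq_0 assms by simp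
  finally have tot: "(\<Sum>h<p. C h) = 0" .
  \<comment> \<open>The shift 0 is exceptional and contributes \<open>p - 1\<close>; each of the
    other \<open>p - 1\<close> shifts contributes \<open>C 1\<close>, which forces
    \<open>C 1 = -1\<close>.\<close>
  have split: "{..<p} = insert 0 {1..<p}" using p by auto
  have "C 0 = (\<Sum>n<p. chi p n ^ 2)" by (simp add: C_def power2_eq_square)
  also have "\<dots> = (\<Sum>n\<in>{1..<p}. 1)"
    unfolding split using nat_dvd_not_less by (subst sum.insert) (auto simp: chi_square intro!: sum.cong)
  finally have C0: "C 0 = real (p - 1)" by simp
  have "(\<Sum>h\<in>{1..<p}. C h) = (\<Sum>h\<in>{1..<p}. C 1)"
    by (intro sum.cong refl eq) (simp add: nat_dvd_not_less)
  then have "0 = real (p - 1) + real (p - 1) * C 1"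
    using tot C0 unfolding split by simp
  then have "real (p - 1) * (C 1 + 1) = 0" by (simp add: algebra_simps)
  then have "C 1 = -1" using p by simp
  then show ?thesis using eq assms by (simp add: C_def)
qed

text \<open>Write \<open>n = i + j * p\<close>. The factor \<open>chi p n\<close> depends only on
  \<open>i\<close>, while for fixed \<open>i\<close> the numbers \<open>i + j * p\<close> run
  through all residues modulo \<open>q\<close>, so the inner sum over \<open>j\<close>
  vanishes.\<close>

lemma sum_chi_mult_period:
  assumes "prime p" "odd p" "prime q" "odd q" "p \<noteq> q"
  shows "(\<Sum>n<p * q. chi p n * chi q n) = 0"
proof -
  have p: "p > 0" and q: "q > 0" using assms prime_gt_0_nat by auto
  have cop: "coprime p q" using assms by (simp add: primes_coprime)
  have "(\<Sum>n<q * p. chi p n * chi q n) = (\<Sum>j<q. \<Sum>n = j * p..<j * p + p. chi p n * chi q n)"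
    by (rule sum.nat_group[symmetric])
  also have "\<dots> = (\<Sum>j<q. \<Sum>i<p. chi p (i + j * p) * chi q (i + j * p))"
  proof (rule sum.cong[OF refl])
    fix j
    show "(\<Sum>n = j * p..<j * p + p. chi p n * chi q n) = (\<Sum>i<p. chi p (i + j * p) * chi q (i + j * p))"
      using sum.shift_bounds_nat_ivl[of "\<lambda>n. chi p n * chi q n" 0 "j * p" p]
      by (simp add: add.commute lessThan_atLeast0)
  qed
  also have "\<dots> = (\<Sum>j<q. \<Sum>i<p. chi p i * chi q (p * j + i))"
    by (intro sum.cong refl) (auto intro!: arg_cong2[of _ _ _ _ "(*)"] chi_cong simp: cong_def ac_simps)
  also have "\<dots> = (\<Sum>i<p. chi p i * (\<Sum>j<q. chi q (p * j + i)))"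
    by (subst sum.swap) (simp add: sum_distrib_left)
  also have "\<dots> = (\<Sum>i<p. chi p i * (\<Sum>j<q. chi q j))"
    by (intro sum.cong refl arg_cong2[of _ _ _ _ "(*)"] sum_affine_mod)
       (use cop q in \<open>auto intro: chi_cong\<close>)
  finally show ?thesis using assms by (simp add: sum_chi_period mult.commute)
qed

lemma sum_periodic_mod:
  fixes f :: "nat \<Rightarrow> 'a::comm_ring_1"
  assumes "q > 0" and per: "\<And>m n. [m = n] (mod q) \<Longrightarrow> f m = f n" and zero: "(\<Sum>n<q. f n) = 0"
  shows "(\<Sum>n<N. f n) = (\<Sum>n<N mod q. f n)"
proof -
  have shift: "(\<Sum>n<t * q + r. f n) = (\<Sum>n<r. f n)" for t r
  proof (induction t)
    case (Suc t)
    have "(\<Sum>n<q + (t * q + r). f n) = (\<Sum>n<q. f n) + (\<Sum>n = q..<q + (t * q + r). f n)"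
      by (simp add: lessThan_atLeast0 sum.atLeastLessThan_concat)
    also have "(\<Sum>n = q..<q + (t * q + r). f n) = (\<Sum>n<t * q + r. f (n + q))"
      using sum.shift_bounds_nat_ivl[of f 0 q "t * q + r"]
      by (simp add: add.commute lessThan_atLeast0)
    also have "\<dots> = (\<Sum>n<t * q + r. f n)"
      by (intro sum.cong refl per) (simp add: cong_def)
    finally show ?case using Suc zero by (simp add: algebra_simps)
  qed simp
  show ?thesis using shift[of "N div q" "N mod q"] by simp
qed

lemma chi_0: "chi p 0 = 0"
  by (simp add: chi_eq_0_iff)

text \<open>Full periods of length \<open>p * q\<close> cancel, which leaves fewer than
  \<open>p * q\<close> terms of size at most 1.\<close>

lemma abs_sum_chi_mult_le:
  assumes "prime p" "odd p" "prime q" "odd q" "p \<noteq> q"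
  shows "\<bar>\<Sum>n=1..N. chi p n * chi q n\<bar> \<le> real (p * q)"
proof -
  have pq: "p * q > 0" using assms prime_gt_0_nat by auto
  \<comment> \<open>The added term \<open>n = 0\<close> vanishes; starting at 0 aligns the range
    with the periods.\<close>
  have "(\<Sum>n=1..N. chi p n * chi q n) = (\<Sum>n<Suc N. chi p n * chi q n)"
    by (intro sum.mono_neutral_left) (auto simp: chi_0 Suc_le_eq)
  also have "\<dots> = (\<Sum>n<Suc N mod (p * q). chi p n * chi q n)"
  proof (rule sum_periodic_mod[OF pq])
    fix m n assume "[m = n] (mod (p * q))"
    then have "[m = n] (mod p)" "[m = n] (mod q)"
      by (metis cong_modulus_mult_nat, metis cong_modulus_mult_nat mult.commute)
    then show "chi p m * chi q m = chi p n * chi q n" by (simp add: chi_cong)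
  qed (use sum_chi_mult_period assms in auto)
  also have "\<bar>\<dots>\<bar> \<le> (\<Sum>n<Suc N mod (p * q). \<bar>chi p n * chi q n\<bar>)"
    by (rule sum_abs)
  also have "\<dots> \<le> (\<Sum>n<Suc N mod (p * q). 1)"
    by (intro sum_mono) (simp add: abs_mult mult_le_one abs_chi_le_1)
  also have "\<dots> = real (Suc N mod (p * q))" by simp
  also have "\<dots> \<le> real (p * q)"
    using mod_less_divisor[OF pq, of "Suc N"] by (intro of_nat_mono) simp
  finally show ?thesis .
qed

section \<open>Mean square of short sums\<close>

lemma chi_correlation_shift:
  assumes "prime p" "odd p" "h < h'" "h' - h < p"
  shows "(\<Sum>n<p. chi p (n + h) * chi p (n + h')) = -1"
proof -
  have p: "p > 0" using assms prime_gt_0_nat by auto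
  have "(\<Sum>n<p. chi p (n + h) * chi p (n + h'))
      = (\<Sum>n<p. chi p (1 * n + h) * chi p ((1 * n + h) + (h' - h)))"
    using assms by simp
  also have "\<dots> = (\<Sum>n<p. chi p n * chi p (n + (h' - h)))"
  proof (rule sum_affine_mod)
    fix m n :: nat assume "[m = n] (mod p)"
    then show "chi p m * chi p (m + (h' - h)) = chi p n * chi p (n + (h' - h))"
      using chi_cong[of m n p] chi_cong[of "m + (h' - h)" "n + (h' - h)" p] by (simp add: cong_add)
  qed (use p in auto)
  also have "\<dots> = -1"
    using assms by (intro chi_correlation) (auto dest: dvd_imp_le)
  finally show ?thesis .
qed

text \<open>After opening the square, each diagonal pair contributes at most \<open>p\<close>. Each
  other pair contributes -1, because \<open>H \<le> p\<close> keeps the two shifts distinct modulo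
  \<open>p\<close>.\<close>

lemma chi_short_sum_second_moment:
  assumes "prime p" "odd p" "H \<le> p"
  shows "(\<Sum>n<p. (\<Sum>h=1..H. chi p (n + h))\<^sup>2) \<le> real H * real p"
proof -
  have "(\<Sum>n<p. (\<Sum>h=1..H. chi p (n + h))\<^sup>2)
      = (\<Sum>n<p. \<Sum>h=1..H. \<Sum>h'=1..H. chi p (n + h) * chi p (n + h'))"
    by (simp add: power2_eq_square sum_product)
  also have "\<dots> = (\<Sum>h=1..H. \<Sum>h'=1..H. \<Sum>n<p. chi p (n + h) * chi p (n + h'))"
    by (subst sum.swap, rule sum.cong[OF refl], rule sum.swap)
  also have "\<dots> \<le> (\<Sum>h=1..H. \<Sum>h'=1..H. if h = h' then real p else 0)"
  proof (intro sum_mono)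
    fix h h' assume h: "h \<in> {1..H}" "h' \<in> {1..H}"
    consider "h = h'" | "h < h'" | "h' < h" by linarith
    then show "(\<Sum>n<p. chi p (n + h) * chi p (n + h')) \<le> (if h = h' then real p else 0)"
    proof cases
      case 1
      have "(\<Sum>n<p. chi p (n + h) * chi p (n + h)) \<le> (\<Sum>n<p. 1)"
        by (intro sum_mono) (simp add: chi_square flip: power2_eq_square)
      then show ?thesis using 1 by simp
    next
      case 2
      then show ?thesis using chi_correlation_shift[of p h h'] assms h by simp
    next
      case 3
      then show ?thesis using chi_correlation_shift[of p h' h] assms h by (simp add: mult.commute)
    qed
  qed
  also have "\<dots> = real H * real p" by simp
  finally show ?thesis .
qed

section \<open>Large character sums are short\<close>

text \<open>Moving the window by one step removes one term and adds one, so each step loses at most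
  2.\<close>

lemma sum_chi_shift_ge:
  "(\<Sum>n<l. chi p (n + Suc h)) \<ge> (\<Sum>n=1..l. chi p n) - 2 * real h"
proof (induction h)
  case 0
  show ?case using sum.shift_bounds_Suc_ivl[of "chi p" 0 l]
    by (simp add: lessThan_atLeast0 atLeastLessThanSuc_atLeastAtMost)
next
  case (Suc h)
  have "(\<Sum>n<l. chi p (n + Suc (Suc h))) = (\<Sum>n<l. chi p (Suc n + Suc h))" by simp
  also have "\<dots> = (\<Sum>n<Suc l. chi p (n + Suc h)) - chi p (0 + Suc h)"
    by (subst sum.lessThan_Suc_shift) simp
  also have "\<dots> = (\<Sum>n<l. chi p (n + Suc h)) + chi p (l + Suc h) - chi p (Suc h)" by simp
  finally show ?case using Suc abs_chi_le_1[of p "l + Suc h"] abs_chi_le_1[of p "Suc h"] by simp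
qed

text \<open>The shift by \<open>h\<close> starts \<open>h - 1\<close> steps after
  \<open>1..l\<close>, so the total loss is at most \<open>H * (H - 1)\<close>.\<close>

lemma sum_sum_chi_shift_ge:
  "(\<Sum>h=1..H. \<Sum>n<l. chi p (n + h)) \<ge> real H * (\<Sum>n=1..l. chi p n) - (real H)\<^sup>2"
proof (induction H)
  case (Suc H)
  then show ?case using sum_chi_shift_ge[where p = p and l = l and h = H]
    by (simp add: algebra_simps power2_eq_square)
qed simp

text \<open>The sum is compared with its average over \<open>H = \<epsilon>l/2\<close> shifts, which is small in mean square.\<close>

lemma large_chi_sum_below_period_imp_short:
  assumes "prime p" "odd p" "0 < \<epsilon>" "\<epsilon> \<le> 1" "l < p" "(\<Sum>n=1..l. chi p n) \<ge> \<epsilon> * real l"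
  shows "\<epsilon> ^ 3 * (real l)\<^sup>2 \<le> 16 * real p"
proof (cases "\<epsilon> * real l < 4")
  case True
  have p: "real p \<ge> 1" using prime_gt_0_nat[OF assms(1)] by simp
  have "(\<epsilon> * real l)\<^sup>2 \<le> 4\<^sup>2" using True assms by (intro power_mono) auto
  then have "\<epsilon> * (\<epsilon> * real l)\<^sup>2 \<le> 1 * 16" using assms by (intro mult_mono) auto
  then show ?thesis using p by (simp add: power2_eq_square power3_eq_cube mult_ac)
next
  case False
  define S where "S = (\<Sum>n=1..l. chi p n)"
  \<comment> \<open>At most half of the lower bound \<open>\<epsilon> * l\<close> is lost to
    shifting; since \<open>\<epsilon> * l \<ge> 4\<close>, rounding down keeps \<open>H\<close>
    above \<open>\<epsilon> * l / 4\<close>.\<close>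
  define H where "H = nat \<lfloor>\<epsilon> * real l / 2\<rfloor>"
  have H1: "real H \<le> \<epsilon> * real l / 2" and H2: "real H \<ge> \<epsilon> * real l / 4"
    using False unfolding H_def by linarith+
  have Hpos: "real H > 0" using H2 False by simp
  have l: "real l > 0" using False by (cases "l = 0") auto
  have "\<epsilon> * real l \<le> 1 * real l" using assms by (intro mult_right_mono) auto
  then have Hp: "H \<le> p" using H1 assms(5) by linarith
  define W where "W = (\<Sum>n<l. \<Sum>h=1..H. chi p (n + h))"
  have "real H * S - (real H)\<^sup>2 \<le> W"
    unfolding W_def S_def by (subst sum.swap) (rule sum_sum_chi_shift_ge)
  moreover have "real H * (\<epsilon> * real l / 2) \<le> real H * (S - real H)"
    using assms(6) H1 Hpos unfolding S_def by (intro mult_left_mono) auto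
  ultimately have W: "real H * (\<epsilon> * real l / 2) \<le> W"
    by (simp add: algebra_simps power2_eq_square)
  have "(real H * (\<epsilon> * real l / 2))\<^sup>2 \<le> W\<^sup>2"
    using W assms Hpos l by (intro power_mono) auto
  also have "W\<^sup>2 \<le> (\<Sum>n<l. (1::real)\<^sup>2) * (\<Sum>n<l. (\<Sum>h=1..H. chi p (n + h))\<^sup>2)"
    using Cauchy_Schwarz_ineq_sum[of "\<lambda>_. 1" "\<lambda>n. \<Sum>h=1..H. chi p (n + h)" "{..<l}"]
    by (simp add: W_def)
  \<comment> \<open>As \<open>l < p\<close> and squares are nonnegative, the range can be extended
    to a full period, where the second moment is known.\<close>
  also have "\<dots> \<le> real l * (\<Sum>n<p. (\<Sum>h=1..H. chi p (n + h))\<^sup>2)"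
    using assms by (simp add: mult_left_mono sum_mono2)
  also have "\<dots> \<le> real l * (real H * real p)"
    by (intro mult_left_mono chi_short_sum_second_moment assms Hp) auto
  finally have "(real H * real l) * (real H * (\<epsilon>\<^sup>2 * real l / 4)) \<le> (real H * real l) * real p"
    by (simp add: power2_eq_square algebra_simps)
  then have "real H * (\<epsilon>\<^sup>2 * real l / 4) \<le> real p"
    using Hpos l by simp
  moreover have "(\<epsilon> * real l / 4) * (\<epsilon>\<^sup>2 * real l / 4) \<le> real H * (\<epsilon>\<^sup>2 * real l / 4)"
    using H2 by (intro mult_right_mono) auto
  ultimately show ?thesis by (simp add: power2_eq_square power3_eq_cube algebra_simps)
qed

text \<open>Removing full periods replaces \<open>l\<close> by its remainder \<open>r\<close>
  without changing the sum. The sum is at most \<open>r\<close>, so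
  \<open>\<epsilon> * l \<le> r\<close>; passing back from \<open>r\<close> to \<open>l\<close>
  costs the extra factor \<open>\<epsilon>^2\<close>.\<close>

lemma large_chi_sum_imp_short:
  assumes "prime p" "odd p" "0 < \<epsilon>" "\<epsilon> \<le> 1" "(\<Sum>n=1..l. chi p n) \<ge> \<epsilon> * real l"
  shows "\<epsilon> ^ 5 * (real l)\<^sup>2 \<le> 16 * real p"
proof -
  define r where "r = l mod p"
  have p: "p > 0" using assms prime_gt_0_nat by auto
  have eq: "(\<Sum>n=1..N. chi p n) = (\<Sum>n<N. chi p (n + 1))" for N
    using sum.shift_bounds_Suc_ivl[of "chi p" 0 N]
    by (simp add: lessThan_atLeast0 atLeastLessThanSuc_atLeastAtMost)
  have zero: "(\<Sum>n<p. chi p (1 * n + 1)) = 0"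
    by (subst sum_affine_mod) (use p assms in \<open>auto simp: sum_chi_period intro: chi_cong\<close>)
  have "(\<Sum>n<l. chi p (n + 1)) = (\<Sum>n<r. chi p (n + 1))"
    unfolding r_def
    by (rule sum_periodic_mod) (use p zero in \<open>auto intro!: chi_cong simp: cong_def mod_Suc\<close>)
  then have r: "\<epsilon> * real l \<le> (\<Sum>n=1..r. chi p n)"
    using assms(5) eq by simp
  have "(\<Sum>n=1..r. chi p n) \<le> (\<Sum>n=1..r. 1)"
    using abs_chi_le_1 abs_le_D1 by (intro sum_mono) blast
  then have lr: "\<epsilon> * real l \<le> real r" using r by simp
  have "r \<le> l" "r < p" using p by (auto simp: r_def)
  then have "\<epsilon> * real r \<le> \<epsilon> * real l"
    using assms by (intro mult_left_mono) auto
  with r have "\<epsilon> * real r \<le> (\<Sum>n=1..r. chi p n)" by linarith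
  then have "\<epsilon> ^ 3 * (real r)\<^sup>2 \<le> 16 * real p"
    using \<open>r < p\<close> assms by (intro large_chi_sum_below_period_imp_short) auto
  moreover have "\<epsilon> ^ 3 * (\<epsilon> * real l)\<^sup>2 \<le> \<epsilon> ^ 3 * (real r)\<^sup>2"
    using lr assms by (intro mult_left_mono power_mono) auto
  moreover have "\<epsilon> ^ 3 * (\<epsilon> * real l)\<^sup>2 = \<epsilon> ^ 5 * (real l)\<^sup>2"
    by (simp add: power_mult_distrib mult.assoc[symmetric] flip: power_add)
  ultimately show ?thesis by simp
qed

section \<open>The divisor bound and powers of character sums\<close>

lemma card_divisors_mult_le:
  fixes a b :: nat
  assumes "a > 0" "b > 0"
  shows "card {d. d dvd a * b} \<le> card {d. d dvd a} * card {d. d dvd b}"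
proof -
  have "{d. d dvd a * b} \<subseteq> (\<lambda>(x, y). x * y) ` ({d. d dvd a} \<times> {d. d dvd b})"
    by (force dest!: division_decomp simp: image_iff)
  then have "card {d. d dvd a * b} \<le> card ({d. d dvd a} \<times> {d. d dvd b})"
    using assms by (intro surj_card_le) auto
  then show ?thesis by (simp add: card_cartesian_product)
qed

lemma card_divisors_prime_power:
  assumes "prime (p::nat)"
  shows "card {d. d dvd p ^ k} \<le> k + 1"
proof -
  have "{d. d dvd p ^ k} \<subseteq> (\<lambda>i. p ^ i) ` {..k}"
    using divides_primepow_nat[OF assms] by auto
  then have "card {d. d dvd p ^ k} \<le> card {..k}"
    by (intro surj_card_le) auto
  then show ?thesis by simp
qed

lemma card_divisors_prod_le:
  fixes A :: "nat set"
  assumes "finite A" "\<And>p. p \<in> A \<Longrightarrow> prime p"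
  shows "card {d. d dvd (\<Prod>p\<in>A. p ^ e p)} \<le> (\<Prod>p\<in>A. e p + 1)"
  using assms
proof (induction A rule: finite_induct)
  case (insert p A)
  have "card {d. d dvd (p ^ e p * (\<Prod>p\<in>A. p ^ e p))}
      \<le> card {d. d dvd p ^ e p} * card {d. d dvd (\<Prod>p\<in>A. p ^ e p)}"
    using insert.prems prime_gt_0_nat by (intro card_divisors_mult_le prod_pos) auto
  also have "\<dots> \<le> (e p + 1) * (\<Prod>p\<in>A. e p + 1)"
    using insert by (intro mult_le_mono card_divisors_prime_power insert.IH) auto
  finally show ?case using insert by simp
qed simp

text \<open>This is the local factor of the divisor bound. If \<open>p\<close> is at least
  \<open>2 powr (1 / \<delta>)\<close>, then \<open>e + 1 \<le> 2 ^ e\<close> suffices with constant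
  1. For smaller \<open>p\<close> the constant comes from
  \<open>1 + e * \<delta> * ln 2 \<le> (2 ^ e) powr \<delta>\<close>.\<close>

lemma Suc_le_prime_powr:
  fixes \<delta> :: real and p :: nat
  assumes "\<delta> > 0" "p \<ge> 2"
  shows "real (e + 1) \<le> (if real p < 2 powr (1 / \<delta>) then max 1 (1 / (\<delta> * ln 2)) else 1) * real (p ^ e) powr \<delta>"
proof (cases "real p < 2 powr (1 / \<delta>)")
  case True
  let ?C = "max 1 (1 / (\<delta> * ln 2))"
  have "\<delta> * ln 2 > 0" using assms by simp
  moreover have "?C \<ge> 1 / (\<delta> * ln 2)" by simp
  ultimately have "?C * (\<delta> * ln 2) \<ge> 1" by (metis pos_divide_le_eq)
  then have "?C * (\<delta> * ln 2) * real e \<ge> 1 * real e" by (intro mult_right_mono) auto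
  then have "real (e + 1) \<le> ?C * (1 + real e * \<delta> * ln 2)"
    by (simp add: algebra_simps)
  also have "\<dots> \<le> ?C * (2 ^ e) powr \<delta>"
  proof (rule mult_left_mono)
    show "1 + real e * \<delta> * ln 2 \<le> (2 ^ e) powr \<delta>"
      using exp_ge_add_one_self[of "real e * \<delta> * ln 2"]
      by (simp add: powr_def ln_realpow mult_ac)
  qed simp
  also have "\<dots> \<le> ?C * real (p ^ e) powr \<delta>"
    using assms power_mono[of 2 "real p" e] by (intro mult_left_mono powr_mono2) auto
  finally show ?thesis using True by simp
next
  case False
  have "real (e + 1) \<le> 2 ^ e" using of_nat_mono[OF less_exp[of e, THEN Suc_leI], where 'a = real] by simp
  also have "\<dots> = ((2 powr (1 / \<delta>)) ^ e) powr \<delta>"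
    using assms by (simp add: powr_power powr_powr powr_realpow)
  also have "\<dots> \<le> real (p ^ e) powr \<delta>"
    using False assms power_mono[of "2 powr (1/\<delta>)" "real p" e] by (intro powr_mono2) auto
  finally show ?thesis using False by simp
qed

text \<open>Multiply the local bounds over the prime factors of \<open>n\<close>. Only primes in the
  finite set \<open>P\<close> cost a factor \<open>c\<close>, so \<open>c ^ card P\<close> serves
  for all \<open>n\<close>.\<close>

lemma divisor_bound:
  fixes \<delta> :: real
  assumes "\<delta> > 0"
  obtains C where "C \<ge> 1" "\<And>n. n > 0 \<Longrightarrow> real (card {d::nat. d dvd n}) \<le> C * real n powr \<delta>"
proof -
  define c where "c = max 1 (1 / (\<delta> * ln 2))"
  define P where "P = {p::nat. real p < 2 powr (1 / \<delta>)}"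
  have c: "c \<ge> 1" by (simp add: c_def)
  have "P \<subseteq> {..nat \<lceil>2 powr (1 / \<delta>)\<rceil>}" unfolding P_def by auto linarith
  then have P: "finite P" using finite_subset by blast
  have "real (card {d::nat. d dvd n}) \<le> c ^ card P * real n powr \<delta>" if n: "n > 0" for n :: nat
  proof -
    let ?A = "prime_factors n" and ?e = "\<lambda>p. multiplicity p n"
    have eq: "n = (\<Prod>p\<in>?A. p ^ ?e p)" using n prime_factorization_nat by blast
    have "card {d. d dvd (\<Prod>p\<in>?A. p ^ ?e p)} \<le> (\<Prod>p\<in>?A. ?e p + 1)"
      by (rule card_divisors_prod_le) auto
    then have "card {d. d dvd n} \<le> (\<Prod>p\<in>?A. ?e p + 1)" using eq by simp
    then have "real (card {d. d dvd n}) \<le> (\<Prod>p\<in>?A. real (?e p + 1))"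
      unfolding of_nat_prod[symmetric] by (rule of_nat_mono)
    also have "\<dots> \<le> (\<Prod>p\<in>?A. (if p \<in> P then c else 1) * real (p ^ ?e p) powr \<delta>)"
    proof (rule prod_mono, intro conjI)
      fix p assume "p \<in> ?A"
      then have "p \<ge> 2" using prime_ge_2_nat by auto
      then show "real (?e p + 1) \<le> (if p \<in> P then c else 1) * real (p ^ ?e p) powr \<delta>"
        using Suc_le_prime_powr[OF assms] unfolding c_def P_def by simp
    qed simp
    also have "\<dots> = (\<Prod>p\<in>?A. if p \<in> P then c else 1) * (\<Prod>p\<in>?A. real (p ^ ?e p) powr \<delta>)"
      by (rule prod.distrib)
    also have "(\<Prod>p\<in>?A. real (p ^ ?e p) powr \<delta>) = real (\<Prod>p\<in>?A. p ^ ?e p) powr \<delta>"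
      unfolding of_nat_prod by (rule prod_powr_distrib[symmetric])
    also have "\<dots> = real n powr \<delta>" using eq by simp
    also have "(\<Prod>p\<in>?A. if p \<in> P then c else 1) = c ^ card (?A \<inter> P)"
      by (simp add: prod.If_cases)
    also have "\<dots> \<le> c ^ card P"
      using c P by (intro power_increasing card_mono) auto
    finally show ?thesis by (simp add: mult_right_mono)
  qed
  then show ?thesis using that[of "c ^ card P"] c by simp
qed

section \<open>Powers of character sums\<close>

text \<open>The number of ordered factorisations of \<open>n\<close> into \<open>k\<close> factors from \<open>{1..l}\<close>.\<close>

fun prod_reps :: "nat \<Rightarrow> nat \<Rightarrow> nat \<Rightarrow> nat" where
  "prod_reps l 0 n = (if n = 1 then 1 else 0)"
| "prod_reps l (Suc k) n = (\<Sum>m | m \<in> {1..l} \<and> m dvd n. prod_reps l k (n div m))"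

lemma prod_reps_eq_0:
  assumes "n > l ^ k"
  shows "prod_reps l k n = 0"
  using assms
proof (induction k arbitrary: n)
  case (Suc k)
  have "prod_reps l k (n div m) = 0" if "m \<in> {1..l}" "m dvd n" for m
  proof (rule Suc.IH)
    have "l * l ^ k < m * (n div m)" using Suc.prems that by simp
    also have "\<dots> \<le> l * (n div m)" using that by (intro mult_le_mono1) auto
    finally show "l ^ k < n div m" by simp
  qed
  then show ?case by (simp cong: conj_cong)
qed simp

text \<open>Every factor in such a factorisation is a divisor of \<open>n\<close>.\<close>

lemma prod_reps_le:
  assumes "n > 0"
  shows "prod_reps l k n \<le> card {d. d dvd n} ^ k"
  using assms
proof (induction k arbitrary: n)
  case (Suc k)
  have fin: "finite {d. d dvd n}" using Suc.prems by simp
  have "prod_reps l (Suc k) n \<le> (\<Sum>m | m \<in> {1..l} \<and> m dvd n. card {d. d dvd n} ^ k)"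
    unfolding prod_reps.simps
  proof (rule sum_mono)
    fix m assume m: "m \<in> {m. m \<in> {1..l} \<and> m dvd n}"
    then have dv: "n div m dvd n" and pos: "n div m > 0"
      using Suc.prems by (auto simp: dvd_div_eq_0_iff intro: div_dvd_iff_mult[THEN iffD2])
    have "prod_reps l k (n div m) \<le> card {d. d dvd n div m} ^ k"
      by (rule Suc.IH[OF pos])
    also have "\<dots> \<le> card {d. d dvd n} ^ k"
      using dv fin by (intro power_mono card_mono) (auto intro: dvd_trans)
    finally show "prod_reps l k (n div m) \<le> card {d. d dvd n} ^ k" .
  qed
  also have "\<dots> = card {m. m \<in> {1..l} \<and> m dvd n} * card {d. d dvd n} ^ k" by simp
  also have "\<dots> \<le> card {d. d dvd n} * card {d. d dvd n} ^ k"
    using fin by (intro mult_le_mono1 card_mono) auto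
  finally show ?case by simp
qed simp

text \<open>Expand the power and collect the \<open>k\<close>-tuples by their product, on which
  complete multiplicativity makes the term depend.\<close>

lemma sum_power_eq_sum_prod_reps:
  fixes f :: "nat \<Rightarrow> 'a::comm_ring_1"
  assumes "f 1 = 1" and mult: "\<And>m n. f (m * n) = f m * f n"
  shows "(\<Sum>m=1..l. f m) ^ k = (\<Sum>n=1..l ^ k. of_nat (prod_reps l k n) * f n)"
proof (induction k)
  case 0
  then show ?case using assms by simp
next
  case (Suc k)
  let ?A = "SIGMA n:{1..l ^ Suc k}. {m. m \<in> {1..l} \<and> m dvd n}"
  let ?T = "{1..l} \<times> {1..l ^ k}"
  have "(\<Sum>n=1..l ^ Suc k. of_nat (prod_reps l (Suc k) n) * f n)
      = (\<Sum>n=1..l ^ Suc k. \<Sum>m | m \<in> {1..l} \<and> m dvd n. of_nat (prod_reps l k (n div m)) * f n)"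
    by (simp add: sum_distrib_right)
  also have "\<dots> = (\<Sum>(n, m)\<in>?A. of_nat (prod_reps l k (n div m)) * f n)"
    by (subst sum.Sigma) auto
  \<comment> \<open>A pair \<open>(n, m)\<close> with \<open>m dvd n\<close> corresponds to
    \<open>(m, n div m)\<close>. Pairs whose cofactor exceeds \<open>l ^ k\<close> have no partner,
    but their terms vanish.\<close>
  also have "\<dots> = (\<Sum>(m, j)\<in>?T. f m * (of_nat (prod_reps l k j) * f j))"
  proof (rule sum.reindex_bij_witness_not_neutral
      [where i = "\<lambda>(m, j). (m * j, m)" and j = "\<lambda>(n, m). (m, n div m)"
        and S' = "{(n, m) \<in> ?A. n div m > l ^ k}" and T' = "{}"])
    show "finite {(n, m) \<in> ?A. n div m > l ^ k}"
      by (rule finite_subset[of _ ?A]) auto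
  next
    fix a assume a: "a \<in> ?A - {(n, m) \<in> ?A. n div m > l ^ k}"
    obtain n m where "a = (n, m)" by (cases a)
    with a have nm: "a = (n, m)" "n \<in> {1..l ^ Suc k}" "m \<in> {1..l}" "m dvd n" "n div m \<le> l ^ k"
      by (auto simp: not_less)
    then have "n div m > 0" by (auto simp: dvd_div_eq_0_iff)
    then show "(case a of (n, m) \<Rightarrow> (m, n div m)) \<in> ?T - {}" using nm by simp
  next
    fix a assume "a \<in> ?A"
    then obtain n m where nm: "a = (n, m)" "m dvd n" by blast
    then have "f n = f m * f (n div m)" by (metis dvd_mult_div_cancel mult)
    then show "(case (case a of (n, m) \<Rightarrow> (m, n div m)) of (m, j) \<Rightarrow> f m * (of_nat (prod_reps l k j) * f j))
        = (case a of (n, m) \<Rightarrow> of_nat (prod_reps l k (n div m)) * f n)"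
      using nm by (simp add: mult_ac)
  next
    fix b assume "b \<in> ?T - {}"
    then obtain m j where mj: "b = (m, j)" "m \<in> {1..l}" "j \<in> {1..l ^ k}" by auto
    then have "m * j \<le> l * l ^ k" by (intro mult_le_mono) auto
    then show "(case b of (m, j) \<Rightarrow> (m * j, m)) \<in> ?A - {(n, m) \<in> ?A. n div m > l ^ k}"
      using mj by (auto simp: Suc_le_eq)
  qed (auto simp: prod_reps_eq_0)
  also have "\<dots> = (\<Sum>m=1..l. f m) * (\<Sum>j=1..l ^ k. of_nat (prod_reps l k j) * f j)"
    by (simp add: sum_product sum.cartesian_product)
  finally show ?case using Suc by simp
qed

section \<open>The large sieve\<close>

lemma sum_square_sum_chi_le:
  assumes "finite B" "\<And>p. p \<in> B \<Longrightarrow> prime p \<and> odd p \<and> real p \<le> x"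
  shows "(\<Sum>n=1..N. (\<Sum>p\<in>B. chi p n)\<^sup>2) \<le> real (card B) * real N + (real (card B))\<^sup>2 * x\<^sup>2"
proof -
  have "(\<Sum>n=1..N. (\<Sum>p\<in>B. chi p n)\<^sup>2) = (\<Sum>n=1..N. \<Sum>p\<in>B. \<Sum>q\<in>B. chi p n * chi q n)"
    by (simp add: power2_eq_square sum_product)
  also have "\<dots> = (\<Sum>p\<in>B. \<Sum>q\<in>B. \<Sum>n=1..N. chi p n * chi q n)"
    by (subst sum.swap, rule sum.cong[OF refl], rule sum.swap)
  also have "\<dots> \<le> (\<Sum>p\<in>B. \<Sum>q\<in>B. (if p = q then real N else 0) + x\<^sup>2)"
  proof (intro sum_mono)
    fix p q assume pq: "p \<in> B" "q \<in> B"
    show "(\<Sum>n=1..N. chi p n * chi q n) \<le> (if p = q then real N else 0) + x\<^sup>2"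
    proof (cases "p = q")
      case True
      have "(\<Sum>n=1..N. chi p n * chi p n) \<le> (\<Sum>n=1..N. 1)"
        by (intro sum_mono) (simp add: chi_square flip: power2_eq_square)
      also have "\<dots> \<le> real N + x\<^sup>2" by simp
      finally show ?thesis using True by simp
    next
      case False
      have "\<bar>\<Sum>n=1..N. chi p n * chi q n\<bar> \<le> real (p * q)"
        using False assms pq by (intro abs_sum_chi_mult_le) auto
      also have "\<dots> \<le> x\<^sup>2"
        using assms(2)[OF pq(1)] assms(2)[OF pq(2)] by (simp add: power2_eq_square mult_mono)
      finally show ?thesis using False by simp
    qed
  qed
  also have "\<dots> = real (card B) * real N + (real (card B))\<^sup>2 * x\<^sup>2"
    using assms(1) by (simp add: sum.distrib power2_eq_square algebra_simps)
  finally show ?thesis .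
qed

text \<open>The weights \<open>prod_reps l k n\<close> do not depend on \<open>p\<close>, so the sum
  over \<open>B\<close> moves inside, and Cauchy--Schwarz separates the weights from the
  characters.\<close>

lemma large_sieve_chi:
  assumes "finite B" "\<And>p. p \<in> B \<Longrightarrow> prime p \<and> odd p \<and> real p \<le> x"
    and "\<epsilon> > 0" "\<And>p. p \<in> B \<Longrightarrow> (\<Sum>n=1..l. chi p n) \<ge> \<epsilon> * real l"
    and D: "\<And>n. n \<in> {1..l ^ k} \<Longrightarrow> real (card {d. d dvd n}) \<le> D"
  shows "(real (card B))\<^sup>2 * (\<epsilon> * real l) ^ (2 * k)
      \<le> D ^ k * real l ^ k * (real (card B) * real l ^ k + (real (card B))\<^sup>2 * x\<^sup>2)"
proof -
  let ?R = "\<lambda>n. real (prod_reps l k n)" and ?N = "l ^ k"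
  have "real (card B) * (\<epsilon> * real l) ^ k = (\<Sum>p\<in>B. (\<epsilon> * real l) ^ k)" by simp
  also have "\<dots> \<le> (\<Sum>p\<in>B. (\<Sum>n=1..l. chi p n) ^ k)"
    using assms by (intro sum_mono power_mono) auto
  also have "\<dots> = (\<Sum>p\<in>B. \<Sum>n=1..?N. ?R n * chi p n)"
    using assms by (intro sum.cong refl sum_power_eq_sum_prod_reps) (auto simp: chi_1[simplified] chi_mult)
  also have "\<dots> = (\<Sum>n=1..?N. ?R n * (\<Sum>p\<in>B. chi p n))"
    by (subst sum.swap) (simp add: sum_distrib_left)
  finally have "(real (card B) * (\<epsilon> * real l) ^ k)\<^sup>2 \<le> (\<Sum>n=1..?N. ?R n * (\<Sum>p\<in>B. chi p n))\<^sup>2"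
    using assms by (intro power_mono) auto
  also have "\<dots> \<le> (\<Sum>n=1..?N. (?R n)\<^sup>2) * (\<Sum>n=1..?N. (\<Sum>p\<in>B. chi p n)\<^sup>2)"
    by (rule Cauchy_Schwarz_ineq_sum)
  also have "\<dots> \<le> (D ^ k * real l ^ k) * (real (card B) * real ?N + (real (card B))\<^sup>2 * x\<^sup>2)"
  proof (intro mult_mono sum_square_sum_chi_le assms)
    \<comment> \<open>One factor \<open>?R n\<close> is bounded by \<open>D ^ k\<close>; the other
      is summed exactly, since the power identity for the constant function 1 counts all
      \<open>l ^ k\<close> tuples.\<close>
    have "(\<Sum>n=1..?N. (?R n)\<^sup>2) \<le> (\<Sum>n=1..?N. D ^ k * ?R n)"
    proof (rule sum_mono)
      fix n assume n: "n \<in> {1..?N}"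
      then have "?R n \<le> real (card {d. d dvd n}) ^ k"
        using prod_reps_le[of n l k] by (simp flip: of_nat_power)
      also have "\<dots> \<le> D ^ k" using D[OF n] by (intro power_mono) auto
      finally show "(?R n)\<^sup>2 \<le> D ^ k * ?R n" by (simp add: power2_eq_square mult_right_mono)
    qed
    also have "\<dots> = D ^ k * real l ^ k"
      using sum_power_eq_sum_prod_reps[of "\<lambda>_. 1 :: real" l k] by (simp flip: sum_distrib_left)
    finally show "(\<Sum>n=1..?N. (?R n)\<^sup>2) \<le> D ^ k * real l ^ k" .
    then show "0 \<le> D ^ k * real l ^ k" by (meson order_trans sum_nonneg zero_le_power2)
  qed (auto intro: sum_nonneg)
  finally show ?thesis by (simp add: power_mult_distrib power_mult mult.commute[of 2 k])
qed

text \<open>Under \<open>large\<close>, the off-diagonal term of the sieve is at most half of the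
  left-hand side and is absorbed there; the diagonal term then bounds \<open>card B\<close>.\<close>

lemma card_large_chi_sum_le:
  assumes "finite B" "\<And>p. p \<in> B \<Longrightarrow> prime p \<and> odd p \<and> real p \<le> x"
    and "\<epsilon> > 0" "\<And>p. p \<in> B \<Longrightarrow> (\<Sum>n=1..l. chi p n) \<ge> \<epsilon> * real l"
    and D: "\<And>n. n \<in> {1..l ^ k} \<Longrightarrow> real (card {d. d dvd n}) \<le> D"
    and "l \<ge> 1" "D \<ge> 0" and large: "2 * D ^ k * x\<^sup>2 \<le> \<epsilon> ^ (2 * k) * real l ^ k"
  shows "real (card B) \<le> 2 * D ^ k / \<epsilon> ^ (2 * k)"
proof (cases "card B = 0")
  case False
  define b where "b = real (card B)"
  define Y where "Y = real l ^ k"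
  define E where "E = \<epsilon> ^ (2 * k)"
  have pos: "b > 0" "Y > 0" "E > 0" using False assms by (auto simp: b_def Y_def E_def)
  have "b\<^sup>2 * (E * Y\<^sup>2) \<le> D ^ k * Y * (b * Y + b\<^sup>2 * x\<^sup>2)"
    using large_sieve_chi[where k = k, OF assms(1-4) D]
    by (simp add: b_def Y_def E_def power_mult_distrib mult.commute[of 2 k] flip: power_mult)
  moreover have "2 * D ^ k * x\<^sup>2 * (b\<^sup>2 * Y) \<le> E * Y * (b\<^sup>2 * Y)"
    using large pos by (intro mult_right_mono) (auto simp: E_def Y_def)
  ultimately have "(b * Y\<^sup>2) * (b * E) \<le> (b * Y\<^sup>2) * (2 * D ^ k)"
    by (simp add: algebra_simps power2_eq_square)
  then have "b * E \<le> 2 * D ^ k" using pos by simp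
  then show ?thesis using pos unfolding b_def E_def by (simp add: pos_le_divide_eq)
qed (use assms in simp)

section \<open>Chebyshev's lower bound\<close>

text \<open>The recurrence of the Leibniz harmonic triangle, whose entries are
  \<open>1 / ((n + 1) * (n choose k))\<close>.\<close>

lemma Leibniz_triangle_rec:
  assumes "k < n"
  shows "1 / (real (Suc n) * real (n choose Suc k))
    = 1 / (real n * real (n - 1 choose k)) - 1 / (real (Suc n) * real (n choose k))"
proof -
  obtain m where n: "n = Suc m" using assms by (cases n) auto
  define c d where "c = real (n choose Suc k)" and "d = real (n choose k)"
  have pos: "c > 0" "d > 0" using assms by (auto simp: c_def d_def)
  have "Suc k * (n choose Suc k) = n * (n - 1 choose k)"
    using Suc_times_binomial[of k m] n by simp
  then have 1: "real n * real (n - 1 choose k) = (real k + 1) * c"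
    unfolding c_def by (metis of_nat_mult of_nat_Suc add.commute)
  have "Suc k * (n choose Suc k) = (n - k) * (n choose k)"
    using \<open>Suc k * (n choose Suc k) = n * (n - 1 choose k)\<close> by (simp only: binomial_absorb_comp)
  then have "real (Suc k) * c = real (n - k) * d"
    unfolding c_def d_def by (metis of_nat_mult)
  then have 2: "(real k + 1) * c = (real n - real k) * d"
    using assms by (simp add: of_nat_diff add.commute)
  have 3: "(real n + 1) * (c * d) = ((real k + 1) * c) * (c + d)"
  proof -
    have "((real k + 1) * c) * (c + d) = ((real n - real k) * d) * c + ((real k + 1) * c) * d"
      by (simp only: distrib_left 2[symmetric])
    then show ?thesis by (simp add: algebra_simps)
  qed
  have "1 / (u * c) + 1 / (u * d) = (c + d) / (u * (c * d))" if "u > 0" for u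
    using pos that by (simp add: field_simps)
  from this[of "real n + 1"]
  have "1 / (real (Suc n) * c) + 1 / (real (Suc n) * d) = (c + d) / ((real n + 1) * (c * d))"
    by (simp add: add.commute)
  also have "\<dots> = (c + d) / (((real k + 1) * c) * (c + d))"
    by (simp only: 3)
  also have "\<dots> = 1 / (real n * real (n - 1 choose k))"
    using pos unfolding 1 by simp
  finally show ?thesis by (simp add: c_def d_def)
qed

text \<open>Every entry of the Leibniz triangle is an integer combination of the numbers \<open>1/m\<close> with \<open>m \<le> N\<close>.\<close>

lemma Leibniz_triangle_dvd:
  assumes D: "\<And>m. m \<in> {1..N} \<Longrightarrow> m dvd D" and "k \<le> n" "n < N"
  shows "Suc n * (n choose k) dvd D"
proof -
  \<comment> \<open>Integrality of the quotient passes through the subtraction in the recurrence,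
    which divisibility itself does not express directly.\<close>
  have "real D / (real (Suc n) * real (n choose k)) \<in> \<int>"
    using assms(2,3)
  proof (induction k arbitrary: n)
    case 0
    then have "Suc n dvd D" by (intro D) auto
    then obtain j where "D = Suc n * j" by auto
    then have "real D / (real (Suc n) * real (n choose 0)) = real j" by (simp del: of_nat_Suc mult_Suc)
    then show ?case by simp
  next
    case (Suc k)
    have "real D / (real (Suc n) * real (n choose Suc k))
        = real D / (real n * real (n - 1 choose k)) - real D / (real (Suc n) * real (n choose k))"
      using Leibniz_triangle_rec[of k n] Suc.prems
      by (simp add: divide_inverse right_diff_distrib)
    moreover have "real D / (real n * real (n - 1 choose k)) \<in> \<int>"
      using Suc.IH[of "n - 1"] Suc.prems by simp
    moreover have "real D / (real (Suc n) * real (n choose k)) \<in> \<int>"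
      using Suc.IH[of n] Suc.prems by simp
    ultimately show ?case by simp
  qed
  then obtain z where "real D / (real (Suc n) * real (n choose k)) = of_int z"
    by (auto elim: Ints_cases)
  moreover have "real (Suc n) * real (n choose k) \<noteq> 0" using assms(2) by simp
  ultimately have "real D = of_int z * (real (Suc n) * real (n choose k))"
    by (metis nonzero_divide_eq_eq)
  then have "real D = of_int z * real (Suc n * (n choose k))" by (simp only: of_nat_mult)
  then have "int D = z * int (Suc n * (n choose k))"
    by (metis of_int_eq_iff of_int_mult of_int_of_nat_eq)
  then show ?thesis by (metis dvd_triv_right int_dvd_int_iff)
qed

text \<open>Multiply, over the primes \<open>p \<le> N\<close>, the largest power of
  \<open>p\<close> not exceeding \<open>N\<close>. Each factor is at most \<open>N\<close>, and the
  product absorbs every prime power dividing some \<open>m \<le> N\<close>.\<close>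

lemma common_multiple_le_power_card_primes:
  assumes "N \<ge> 1"
  obtains D where "D > 0" "D \<le> N ^ card {p::nat. prime p \<and> p \<le> N}" "\<And>m. m \<in> {1..N} \<Longrightarrow> m dvd D"
proof -
  define P where "P = {p::nat. prime p \<and> p \<le> N}"
  define e where "e = (\<lambda>p. Max {i. p ^ i \<le> N})"
  have finP: "finite P" by (simp add: P_def)
  have fin: "finite {i. p ^ i \<le> N}" if "p \<in> P" for p
  proof -
    have "i < N" if "p ^ i \<le> N" for i
    proof -
      have "i < 2 ^ i" by (rule less_exp)
      also have "\<dots> \<le> p ^ i"
        using prime_ge_2_nat[of p] \<open>p \<in> P\<close> by (intro power_mono) (auto simp: P_def)
      finally show ?thesis using that by simp
    qed
    then have "{i. p ^ i \<le> N} \<subseteq> {..<N}" by blast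
    then show ?thesis by (rule finite_subset) simp
  qed
  have e: "p ^ e p \<le> N" if "p \<in> P" for p
  proof -
    have "0 \<in> {i. p ^ i \<le> N}" using assms by simp
    then have "e p \<in> {i. p ^ i \<le> N}"
      unfolding e_def by (intro Max_in fin that) blast
    then show ?thesis by simp
  qed
  have "(\<Prod>p\<in>P. p ^ e p) \<le> (\<Prod>p\<in>P. N)" using e by (intro prod_mono) auto
  then have "(\<Prod>p\<in>P. p ^ e p) \<le> N ^ card P" by simp
  moreover have "(\<Prod>p\<in>P. p ^ e p) > 0" by (intro prod_pos) (auto simp: P_def prime_gt_0_nat)
  moreover have "m dvd (\<Prod>p\<in>P. p ^ e p)" if m: "m \<in> {1..N}" for m
  proof -
    have "(\<Prod>p\<in>prime_factors m. p ^ multiplicity p m) dvd (\<Prod>p\<in>P. p ^ e p)"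
    proof (rule prod_dvd_prod_subset2[OF finP])
      have le: "p \<le> N" if "p dvd m" for p using m that dvd_imp_le[of p m] by auto
      then show sub: "prime_factors m \<subseteq> P" by (auto simp: P_def)
      fix p assume p: "p \<in> prime_factors m"
      have "p ^ multiplicity p m \<le> m" using m by (intro dvd_imp_le multiplicity_dvd) auto
      then have "multiplicity p m \<le> e p"
        unfolding e_def using m p sub by (intro Max_ge fin) auto
      then show "p ^ multiplicity p m dvd p ^ e p" by (rule le_imp_power_dvd)
    qed
    then show ?thesis using m prime_factorization_nat[of m] by simp
  qed
  ultimately show ?thesis using that unfolding P_def by blast
qed

text \<open>The number \<open>(2 * n + 1) * (2 * n choose n)\<close> divides the common multiple of
  \<open>1..2 * n + 1\<close>, and the central binomial coefficient is at least
  \<open>4 ^ n / (2 * n)\<close>.\<close>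

lemma four_power_le_power_card_primes:
  assumes "n > 0"
  shows "4 ^ n \<le> (2 * n + 1) ^ card {p::nat. prime p \<and> p \<le> 2 * n + 1}"
proof -
  obtain D where D: "D > 0" "D \<le> (2 * n + 1) ^ card {p::nat. prime p \<and> p \<le> 2 * n + 1}"
    "\<And>m. m \<in> {1..2 * n + 1} \<Longrightarrow> m dvd D"
    using common_multiple_le_power_card_primes[of "2 * n + 1"] by auto
  have "real (4 ^ n) \<le> real (2 * n * (2 * n choose n))"
    using central_binomial_lower_bound[OF assms] assms by (simp add: field_simps)
  then have "4 ^ n \<le> 2 * n * (2 * n choose n)" by (simp only: of_nat_le_iff)
  also have "\<dots> \<le> Suc (2 * n) * (2 * n choose n)" by simp
  also have "\<dots> \<le> D" using Leibniz_triangle_dvd[of "2 * n + 1" D n "2 * n"] D by (intro dvd_imp_le) auto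
  finally show ?thesis using D by simp
qed

lemma pi_odd_lower_bound:
  assumes "x \<ge> 3"
  shows "(x - 3) * ln 2 \<le> (real (pi_odd x) + 1) * ln x"
proof -
  define n where "n = nat \<lfloor>(x - 1) / 2\<rfloor>"
  have n: "n > 0" "real (2 * n + 1) \<le> x" "real n \<ge> (x - 3) / 2"
  proof -
    have "\<lfloor>(x - 1) / 2\<rfloor> \<ge> 1" using assms by (simp add: le_floor_iff)
    then have *: "n > 0" "real n = of_int \<lfloor>(x - 1) / 2\<rfloor>" by (auto simp: n_def)
    then show "n > 0" "real (2 * n + 1) \<le> x" "real n \<ge> (x - 3) / 2"
      using floor_correct[of "(x - 1) / 2"] by (auto simp: field_simps)
  qed
  let ?P = "{p::nat. prime p \<and> p \<le> 2 * n + 1}" and ?O = "{p::nat. prime p \<and> odd p \<and> real p \<le> x}"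
  have fin: "finite ?O"
    by (rule finite_subset[of _ "{..nat \<lfloor>x\<rfloor>}"]) (auto simp: le_nat_floor)
  \<comment> \<open>The prime 2 is not counted by \<open>pi_odd\<close>; this is the source of the
    summand 1.\<close>
  have "?P \<subseteq> insert 2 ?O"
  proof
    fix p assume p: "p \<in> ?P"
    then have "real p \<le> real (2 * n + 1)" by (intro of_nat_mono) simp
    then have "real p \<le> x" using n(2) by linarith
    then show "p \<in> insert 2 ?O"
      using p prime_odd_nat[of p] prime_ge_2_nat[of p] by (cases "p = 2") auto
  qed
  then have "card ?P \<le> card (insert 2 ?O)" using fin by (intro card_mono) auto
  also have "\<dots> \<le> pi_odd x + 1" using fin by (simp add: pi_odd_def card_insert_if)
  finally have c: "card ?P \<le> pi_odd x + 1" .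
  have "(4::real) ^ n = real (4 ^ n)" by simp
  also have "\<dots> \<le> real ((2 * n + 1) ^ card ?P)"
    using four_power_le_power_card_primes[OF n(1)] by (rule of_nat_mono)
  also have "\<dots> = real (2 * n + 1) ^ card ?P" by simp
  also have "\<dots> \<le> x ^ card ?P" using n by (intro power_mono) auto
  also have "\<dots> \<le> x ^ (pi_odd x + 1)" using c assms by (intro power_increasing) auto
  finally have "ln (4 ^ n) \<le> ln (x ^ (pi_odd x + 1))" using assms by simp
  then have "real n * ln 4 \<le> (real (pi_odd x) + 1) * ln x"
    using assms by (simp only: ln_realpow) (simp add: add.commute)
  moreover have "ln (4::real) = 2 * ln 2" using ln_realpow[of 2 2] by simp
  moreover have "(x - 3) / 2 * (2 * ln 2) \<le> real n * (2 * ln 2)"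
    using n by (intro mult_right_mono) auto
  moreover have "(x - 3) / 2 * (2 * ln 2) = (x - 3) * ln 2" by simp
  ultimately show ?thesis by (metis order_trans)
qed

lemma eventually_pi_odd_ge: "\<forall>\<^sub>F x in at_top. real (pi_odd x) \<ge> x powr (11/12)"
proof -
  have "\<forall>\<^sub>F x::real in at_top. x powr (11/12) \<le> (x - 3) * ln 2 / ln x - 1" by real_asymp
  then show ?thesis using eventually_ge_at_top[of 3]
  proof eventually_elim
    case (elim x)
    then have "(x - 3) * ln 2 / ln x \<le> real (pi_odd x) + 1"
      using pi_odd_lower_bound[of x] by (simp add: divide_le_eq)
    with elim show ?case by linarith
  qed
qed

section \<open>Summation over the lengths\<close>

text \<open>One threshold for \<open>x\<close> serves all lengths \<open>l\<close> at once, so that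
  the bound can be summed over \<open>l\<close>.\<close>

lemma eventually_card_large_char_sum_le:
  assumes "0 < \<epsilon>" "\<epsilon> \<le> 1" "0 < \<theta>"
  obtains c where "c > 0" and "\<forall>\<^sub>F x in at_top. \<forall>l \<ge> 1. real l > x powr \<theta> \<longrightarrow>
    real (card {p::nat. prime p \<and> odd p \<and> real p \<le> x \<and> real_of_int (char_sum l p) \<ge> \<epsilon> * real l})
      \<le> (if real l \<le> c * x powr (1/2) then c * x powr (1/12) else 0)"
proof -
  \<comment> \<open>This makes \<open>l ^ k \<ge> x ^ 3\<close>, a full power of \<open>x\<close>
    above the off-diagonal \<open>x^2\<close>.\<close>
  define k where "k = nat \<lceil>3 / \<theta>\<rceil>"
  have k\<theta>: "real k * \<theta> \<ge> 3" and k: "k > 0"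
  proof -
    have "real k \<ge> 3 / \<theta>" unfolding k_def by (rule real_nat_ceiling_ge)
    then show "real k * \<theta> \<ge> 3" using assms by (simp add: field_simps)
    then show "k > 0" by (cases k) auto
  qed
  \<comment> \<open>With \<open>l \<le> K x^(1/2)\<close> the \<open>k\<close>-th power of the divisor bound at \<open>l^k\<close> is \<open>O(l^(k\<^sup>2 \<delta>)) = O(x^(1/12))\<close>.\<close>
  define \<delta> where "\<delta> = 1 / (6 * (real k)\<^sup>2)"
  have "\<delta> > 0" using k by (simp add: \<delta>_def)
  then obtain C where C: "C \<ge> 1" "\<And>n. n > 0 \<Longrightarrow> real (card {d::nat. d dvd n}) \<le> C * real n powr \<delta>"
    using divisor_bound by blast
  \<comment> \<open>Solving \<open>\<epsilon> ^ 5 * l^2 \<le> 16 * x\<close> for \<open>l\<close>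
    gives this constant.\<close>
  define K where "K = sqrt (16 / \<epsilon> ^ 5)"
  have K: "K > 0" using assms by (simp add: K_def)
  \<comment> \<open>The constant in \<open>D ^ k \<le> M * x powr (1/12)\<close>, where
    \<open>D\<close> bounds the divisor function up to \<open>l ^ k\<close>.\<close>
  define M where "M = C ^ k * K powr (1/6)"
  have M: "M > 0" using C K by (simp add: M_def)
  define e where "e = \<epsilon> ^ (2 * k)"
  have e: "e > 0" using assms by (simp add: e_def)
  \<comment> \<open>A single constant covers both the length cutoff and the cardinality
    bound.\<close>
  define c where "c = max K (2 * M / e)"
  have c: "c > 0" "K \<le> c" "2 * M / e \<le> c" using K by (auto simp: c_def)
  have "\<forall>\<^sub>F x::real in at_top. 2 * (M * x powr (1/12)) * x\<^sup>2 \<le> e * x ^ 3"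
    using M e by real_asymp
  then have "\<forall>\<^sub>F x::real in at_top. x \<ge> 1 \<and> 2 * (M * x powr (1/12)) * x\<^sup>2 \<le> e * x ^ 3"
    using eventually_ge_at_top[of 1] by eventually_elim auto
  then have "\<forall>\<^sub>F x in at_top. \<forall>l \<ge> 1. real l > x powr \<theta> \<longrightarrow>
    real (card {p::nat. prime p \<and> odd p \<and> real p \<le> x \<and> real_of_int (char_sum l p) \<ge> \<epsilon> * real l})
      \<le> (if real l \<le> c * x powr (1/2) then c * x powr (1/12) else 0)"
  proof (eventually_elim, intro allI impI)
    fix x :: real and l :: nat
    assume x: "x \<ge> 1 \<and> 2 * (M * x powr (1/12)) * x\<^sup>2 \<le> e * x ^ 3"
      and l: "1 \<le> l" "x powr \<theta> < real l"
    define B where "B = {p::nat. prime p \<and> odd p \<and> real p \<le> x \<and> real_of_int (char_sum l p) \<ge> \<epsilon> * real l}"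
    have finB: "finite B"
      by (rule finite_subset[of _ "{..nat \<lfloor>x\<rfloor>}"]) (auto simp: B_def le_nat_floor)
    have B: "prime p \<and> odd p \<and> real p \<le> x" "(\<Sum>n=1..l. chi p n) \<ge> \<epsilon> * real l" if "p \<in> B" for p
      using that by (auto simp: B_def char_sum_eq_sum_chi)
    have lK: "real l \<le> K * x powr (1/2)" if "p \<in> B" for p
    proof -
      have "\<epsilon> ^ 5 * (real l)\<^sup>2 \<le> 16 * real p"
        using B[OF that] assms by (intro large_chi_sum_imp_short) auto
      also have "\<dots> \<le> 16 * x" using B[OF that] by simp
      finally have "(real l)\<^sup>2 \<le> 16 / \<epsilon> ^ 5 * x" using assms by (simp add: field_simps)
      then have "real l \<le> sqrt (16 / \<epsilon> ^ 5 * x)" by (rule real_le_rsqrt)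
      also have "\<dots> = K * x powr (1/2)" unfolding K_def
        using x by (subst powr_half_sqrt) (auto simp only: real_sqrt_mult)
      finally show ?thesis .
    qed
    have "real (card B) \<le> (if real l \<le> c * x powr (1/2) then c * x powr (1/12) else 0)"
    proof (cases "B = {}")
      case False
      then have le: "real l \<le> K * x powr (1/2)" using lK by auto
      also have "\<dots> \<le> c * x powr (1/2)" using c by (intro mult_right_mono) auto
      finally have lc: "real l \<le> c * x powr (1/2)" .
      define D where "D = C * (real l ^ k) powr \<delta>"
      have "D ^ k = C ^ k * ((real l powr (real k * \<delta>)) ^ k)"
        using l by (simp add: D_def power_mult_distrib powr_powr flip: powr_realpow)
      also have "(real l powr (real k * \<delta>)) ^ k = real l powr (1/6)"
        using l k by (simp add: powr_power \<delta>_def power2_eq_square)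
      also have "C ^ k * real l powr (1/6) \<le> C ^ k * (K * x powr (1/2)) powr (1/6)"
        using le C by (intro mult_left_mono powr_mono2) auto
      also have "\<dots> = M * x powr (1/12)"
        using K x by (simp add: M_def powr_mult powr_powr)
      finally have D: "D ^ k \<le> M * x powr (1/12)" .
      have "x ^ 3 \<le> (x powr \<theta>) ^ k"
        using x k\<theta> by (simp add: powr_power mult.commute powr_mono flip: powr_numeral)
      also have "\<dots> \<le> real l ^ k" using l by (intro power_mono) auto
      finally have xl: "x ^ 3 \<le> real l ^ k" .
      have "2 * D ^ k * x\<^sup>2 \<le> 2 * (M * x powr (1/12)) * x\<^sup>2"
        using D by (intro mult_right_mono) auto
      also have "\<dots> \<le> e * x ^ 3" using x by simp
      also have "\<dots> \<le> e * real l ^ k" using xl e by simp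
      finally have large: "2 * D ^ k * x\<^sup>2 \<le> \<epsilon> ^ (2 * k) * real l ^ k" by (simp add: e_def)
      have "real (card B) \<le> 2 * D ^ k / \<epsilon> ^ (2 * k)"
      proof (rule card_large_chi_sum_le[OF finB B(1) assms(1) B(2) _ l(1) _ large])
        fix n assume n: "n \<in> {1..l ^ k}"
        then have "real (card {d. d dvd n}) \<le> C * real n powr \<delta>" using C by simp
        also have "\<dots> \<le> D"
          unfolding D_def using n C \<open>\<delta> > 0\<close> by (intro mult_left_mono powr_mono2) (auto simp flip: of_nat_power)
        finally show "real (card {d. d dvd n}) \<le> D" .
      qed (use C in \<open>auto simp: D_def\<close>)
      also have "\<dots> \<le> 2 * (M * x powr (1/12)) / e"
        unfolding e_def[symmetric] using D e by (intro divide_right_mono) auto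
      also have "\<dots> = 2 * M / e * x powr (1/12)" by simp
      also have "\<dots> \<le> c * x powr (1/12)" using c by (intro mult_right_mono) auto
      finally show ?thesis using lc by simp
    qed (use c in simp)
    then show "real (card {p::nat. prime p \<and> odd p \<and> real p \<le> x \<and> real_of_int (char_sum l p) \<ge> \<epsilon> * real l})
      \<le> (if real l \<le> c * x powr (1/2) then c * x powr (1/12) else 0)"
      by (simp only: B_def)
  qed
  with c(1) show ?thesis by (rule that)
qed

theorem theorem2p6:
  fixes \<epsilon> \<kappa> \<beta> :: real
  assumes "0 < \<epsilon>" "\<epsilon> \<le> 1" "0 < \<kappa>" "\<kappa> < 1/6" "0 < \<beta>" "\<beta> < 1/3 - 2*\<kappa>"
  shows "\<exists>C. \<forall>\<^sub>F x in at_top.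
           (\<lambda>l. P_prob \<epsilon> l x) summable_on {l::nat. 1 \<le> l \<and> real l > x powr (1/6 - \<kappa>)} \<and>
           \<bar>(\<Sum>\<^sub>\<infinity>l\<in>{l::nat. 1 \<le> l \<and> real l > x powr (1/6 - \<kappa>)}. P_prob \<epsilon> l x)\<bar>
             \<le> C * x powr (-\<beta>)"
proof -
  obtain c where c: "c > 0" and ev: "\<forall>\<^sub>F x in at_top. \<forall>l \<ge> 1. real l > x powr (1/6 - \<kappa>) \<longrightarrow>
    real (card {p::nat. prime p \<and> odd p \<and> real p \<le> x \<and> real_of_int (char_sum l p) \<ge> \<epsilon> * real l})
      \<le> (if real l \<le> c * x powr (1/2) then c * x powr (1/12) else 0)"
    using eventually_card_large_char_sum_le[of \<epsilon> "1/6 - \<kappa>"] assms by auto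
  show ?thesis
  \<comment> \<open>One factor \<open>c\<close> bounds the number of contributing lengths, the other
    the primes for each length.\<close>
  proof (rule exI[of _ "c\<^sup>2"])
    show "\<forall>\<^sub>F x in at_top.
           (\<lambda>l. P_prob \<epsilon> l x) summable_on {l::nat. 1 \<le> l \<and> real l > x powr (1/6 - \<kappa>)} \<and>
           \<bar>(\<Sum>\<^sub>\<infinity>l\<in>{l::nat. 1 \<le> l \<and> real l > x powr (1/6 - \<kappa>)}. P_prob \<epsilon> l x)\<bar>
             \<le> c\<^sup>2 * x powr (-\<beta>)"
      using ev eventually_pi_odd_ge eventually_ge_at_top[of 1]
    proof eventually_elim
      case (elim x)
      define L where "L = {l::nat. 1 \<le> l \<and> real l > x powr (1/6 - \<kappa>)}"
      \<comment> \<open>All terms outside this finite set vanish, so the infinite sum is a finite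
        one.\<close>
      define F where "F = {l \<in> L. real l \<le> c * x powr (1/2)}"
      define f where "f = (\<lambda>l. P_prob \<epsilon> l x)"
      have f0: "f l \<ge> 0" for l by (simp add: f_def P_prob_def)
      have "F \<subseteq> {1..nat \<lfloor>c * x powr (1/2)\<rfloor>}" by (auto simp: F_def L_def le_nat_floor)
      then have finF: "finite F" and "card F \<le> nat \<lfloor>c * x powr (1/2)\<rfloor>"
        using finite_subset card_mono[of "{1..nat \<lfloor>c * x powr (1/2)\<rfloor>}" F] by auto
      then have cardF: "real (card F) \<le> c * x powr (1/2)"
        using c by (simp add: le_nat_iff le_floor_iff)
      have zero: "f l = 0" if "l \<in> L - F" for l
        using that elim(1) unfolding f_def P_prob_def F_def L_def by auto
      have bound: "f l \<le> c * x powr (1/12) / x powr (11/12)" if "l \<in> F" for l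
        unfolding f_def P_prob_def
      proof (rule frac_le)
        show "real (card {p::nat. prime p \<and> odd p \<and> real p \<le> x \<and> real_of_int (char_sum l p) \<ge> \<epsilon> * real l})
          \<le> c * x powr (1/12)"
          using that elim(1) unfolding F_def L_def by auto
      qed (use c elim in auto)
      have "f summable_on L \<longleftrightarrow> f summable_on F"
        by (rule summable_on_cong_neutral) (use zero in \<open>auto simp: F_def\<close>)
      then have summ: "f summable_on L" using finF by simp
      have "infsum f L = infsum f F"
        by (rule infsum_cong_neutral) (use zero in \<open>auto simp: F_def\<close>)
      also have "\<dots> = (\<Sum>l\<in>F. f l)" using finF by simp
      finally have eq: "infsum f L = (\<Sum>l\<in>F. f l)" .
      have "(\<Sum>l\<in>F. f l) \<le> real (card F) * (c * x powr (1/12) / x powr (11/12))"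
        using bound by (intro sum_bounded_above) auto
      also have "\<dots> \<le> (c * x powr (1/2)) * (c * x powr (1/12) / x powr (11/12))"
        using cardF c by (intro mult_right_mono) auto
      also have "\<dots> = c\<^sup>2 * (x powr (1/2) * x powr (1/12) / x powr (11/12))"
        by (simp add: power2_eq_square)
      also have "x powr (1/2) * x powr (1/12) / x powr (11/12) = x powr (-1/3)"
        by (simp flip: powr_add powr_diff)
      \<comment> \<open>The hypotheses give \<open>\<beta> < 1/3\<close>, and
        \<open>x \<ge> 1\<close>.\<close>
      also have "c\<^sup>2 * x powr (-1/3) \<le> c\<^sup>2 * x powr (-\<beta>)"
        using elim(3) assms by (intro mult_left_mono powr_mono) auto
      finally have "infsum f L \<le> c\<^sup>2 * x powr (-\<beta>)" using eq by simp
      moreover have "infsum f L \<ge> 0" using eq f0 by (simp add: sum_nonneg)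
      ultimately show ?case using summ unfolding L_def f_def by simp
    qed
  qed
qed

end
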